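(* Let $\lambda_1,\dots,\lambda_n\in\mathbb R$, let $A$ be a unital complex $C^*$-algebra, and let $C$ be a connected component of $S_p(A)$. Then $C$ is a relatively open subset of $S_p(A)$. Let $a_0,a_1\in C$. Then $a_0$ and $a_1$ are similar via some unitary $s\in A$, i.e. $$a_1=s^{-1}a_0s=s^*a_0s,\qquad\text{where } s^{-1}=s^*.$$ Here, for some integer $m\ge1$, $s$ is of the form $$s=e^{ic_1}\cdots e^{ic_m},\qquad\text{where } c_i=c_i^*\in A.$$ This gives a self-adjoint analytic path $a(t)=a(t)^*\in C$, $t\in[0,1]$, from $a_0$ to $a_1$, namely $$a(t)=e^{-ic_mt}\cdots e^{-ic_1t}a_0e^{ic_1t}\cdots e^{ic_mt}.$$
   Context: Fix an integer $n\ge2$ and distinct $\lambda_1,\dots,\lambda_n$, and let $p(\lambda)=\prod_{i=1}^n(\lambda-\lambda_i)$. For a unital complex $C^*$-algebra $A$, $S_p(A)=\{a\in A\mid a=a^*,\ p(a)=0\}$, with the norm topology of $A$. *)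

theory Defs
  imports "HOL-Analysis.Analysis" "HOL-Computational_Algebra.Polynomial"
begin

text \<open>
  Unital complex C*-algebras with \<open>1 \<noteq> 0\<close>. The distribution has no class of complex Banach
  algebras, so complex scalar multiplication is added on top of the real one and required to
  extend it. Completeness comes from \<^class>\<open>banach\<close>, submultiplicativity of the norm and
  \<open>norm 1 = 1\<close> from \<^class>\<open>real_normed_algebra_1\<close>.
\<close>

class cstar_algebra = real_normed_algebra_1 + banach +
  fixes scaleC :: "complex \<Rightarrow> 'a \<Rightarrow> 'a"  (infixr \<open>*\<^sub>C\<close> 75)
    and adj :: "'a \<Rightarrow> 'a"
  assumes scaleC_add_right: "z *\<^sub>C (x + y) = z *\<^sub>C x + z *\<^sub>C y"
    and scaleC_add_left: "(z + w) *\<^sub>C x = z *\<^sub>C x + w *\<^sub>C x"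
    and scaleC_scaleC: "z *\<^sub>C (w *\<^sub>C x) = (z * w) *\<^sub>C x"
    and scaleR_scaleC: "scaleR r x = complex_of_real r *\<^sub>C x"
    and mult_scaleC_left: "(z *\<^sub>C x) * y = z *\<^sub>C (x * y)"
    and mult_scaleC_right: "x * (z *\<^sub>C y) = z *\<^sub>C (x * y)"
    and norm_scaleC: "norm (z *\<^sub>C x) = cmod z * norm x"
    and adj_adj: "adj (adj x) = x"
    and adj_add: "adj (x + y) = adj x + adj y"
    and adj_scaleC: "adj (z *\<^sub>C x) = cnj z *\<^sub>C adj x"
    and adj_mult: "adj (x * y) = adj y * adj x"
    and cstar_identity: "norm (adj x * x) = (norm x)\<^sup>2"

definition selfadjoint :: "'a::cstar_algebra \<Rightarrow> bool" where
  "selfadjoint a \<longleftrightarrow> a = adj a"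

definition unitary :: "'a::cstar_algebra \<Rightarrow> bool" where
  "unitary s \<longleftrightarrow> adj s * s = 1 \<and> s * adj s = 1"

text \<open>The class operation \<^const>\<open>inverse\<close> is only available in division rings. The following
  value is meaningful only if \<open>s\<close> has a (then unique) two-sided inverse.\<close>

definition mult_inv :: "'a::monoid_mult \<Rightarrow> 'a" where
  "mult_inv s = (THE r. r * s = 1 \<and> s * r = 1)"

text \<open>\<^const>\<open>poly\<close> evaluates only in the (commutative) coefficient ring.\<close>

definition alg_poly :: "complex poly \<Rightarrow> 'a::cstar_algebra \<Rightarrow> 'a" where
  "alg_poly p a = (\<Sum>k\<le>degree p. coeff p k *\<^sub>C a ^ k)"

definition sa_roots :: "complex poly \<Rightarrow> 'a::cstar_algebra set" where
  "sa_roots p = {a. selfadjoint a \<and> alg_poly p a = 0}"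

text \<open>As for \<^const>\<open>analytic_on\<close>, the function is required to be given by a convergent
  power series on a full neighbourhood of each point of \<open>S\<close>.\<close>

definition real_analytic_on :: "(real \<Rightarrow> 'a::real_normed_vector) \<Rightarrow> real set \<Rightarrow> bool" where
  "real_analytic_on f S \<longleftrightarrow>
     (\<forall>x\<in>S. \<exists>u. \<exists>r>0. \<forall>t\<in>ball x r. (\<lambda>k. scaleR ((t - x) ^ k) (u k)) sums f t)"

end

theory Submission
  imports Defs "HOL-Computational_Algebra.Field_as_Ring"
    "HOL-Computational_Algebra.Polynomial_Factorial"
    "HOL-Computational_Algebra.Fundamental_Theorem_Algebra"
begin

text \<open>
  Everything rests on one local fact: if \<open>a\<close> and \<open>b\<close> are self-adjoint roots of \<open>p\<close> and \<open>b\<close> is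
  close enough to \<open>a\<close>, then \<open>b = e\<^sup>-\<^sup>i\<^sup>c a e\<^sup>i\<^sup>c\<close> for some self-adjoint \<open>c\<close>
  (\<open>nearby_roots_conjugate\<close>). Given this, \<open>t \<mapsto> e\<^sup>-\<^sup>i\<^sup>t\<^sup>c a e\<^sup>i\<^sup>t\<^sup>c\<close> joins \<open>a\<close> to \<open>b\<close> among the
  roots, so a component contains a neighbourhood of each of its points and is open. Moreover
  ``\<open>b\<close> is conjugate to \<open>a\<close> by a product of unitary exponentials'' is an equivalence relation whose
  classes are open in \<open>C\<close>, so the connected set \<open>C\<close> is a single class. Inserting the parameter \<open>t\<close>
  into each factor of the product gives the path from \<open>a\<^sub>0\<close> to \<open>a\<^sub>1\<close>; it stays in \<open>C\<close> because
  conjugation by a unitary maps the roots to roots, and it is analytic as a product of entire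
  functions.

  The local fact needs an element \<open>v\<close> close to \<open>1\<close> with \<open>a v = v b\<close>, that is, one that intertwines
  \<open>a\<close> and \<open>b\<close>. It comes from a difference quotient \<open>P\<close> of \<open>p\<close> in two noncommuting variables,
  \<open>x P(x, y) - P(x, y) y = p(x) - p(y)\<close>: for roots \<open>a\<close>, \<open>b\<close> it gives \<open>a P(a, b) = P(a, b) b\<close>, and
  \<open>P(a, a) = p'(a)\<close> is invertible because \<open>p\<close> is coprime to \<open>p'\<close>, the \<open>\<lambda>\<^sub>i\<close> being
  distinct. So \<open>v = p'(a)\<^sup>-\<^sup>1 P(a, b)\<close> intertwines and tends to \<open>1\<close> as \<open>b\<close> tends to \<open>a\<close>
  (\<open>intertwiner_near_one\<close>). Since \<open>a\<close> and \<open>b\<close> are self-adjoint, \<open>v\<^sup>* v\<close> commutes with \<open>b\<close>, so the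
  unitary part \<open>u = v (v\<^sup>* v)\<^sup>-\<^sup>1\<^sup>/\<^sup>2\<close> of the polar decomposition intertwines as well.

  Both the inverse square root and \<open>c = -i log u\<close> come from a logarithm near \<open>1\<close>, which is found as a
  fixed point (\<open>small_log_exists\<close>). Its uniqueness among small elements replaces spectral
  arguments: it shows that logarithms of self-adjoint elements are self-adjoint and that logarithms
  of unitaries are skew-adjoint.
\<close>

section \<open>Exponential and logarithm near 1 in a Banach algebra\<close>

lemma norm_diff_power_le:
  fixes y z :: "'a::real_normed_algebra_1"
  assumes "norm y \<le> r" "norm z \<le> r"
  shows "norm (y ^ Suc k - z ^ Suc k) \<le> real (Suc k) * r ^ k * norm (y - z)"
proof (induction k)
  case (Suc k)
  have r: "0 \<le> r"
    using assms(1) norm_ge_zero order_trans by blast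
  have "y ^ Suc (Suc k) - z ^ Suc (Suc k) = y * (y ^ Suc k - z ^ Suc k) + (y - z) * z ^ Suc k"
    by (simp add: algebra_simps)
  also have "norm \<dots> \<le> norm y * norm (y ^ Suc k - z ^ Suc k) + norm (y - z) * norm (z ^ Suc k)"
    by (intro norm_triangle_mono norm_mult_ineq)
  also have "\<dots> \<le> r * (real (Suc k) * r ^ k * norm (y - z)) + norm (y - z) * r ^ Suc k"
  proof (intro add_mono mult_mono)
    show "norm (z ^ Suc k) \<le> r ^ Suc k"
      using norm_power_ineq[of z "Suc k"] power_mono[OF assms(2), of "Suc k"] by simp
  qed (use assms r Suc.IH in auto)
  also have "\<dots> = real (Suc (Suc k)) * r ^ Suc k * norm (y - z)"
    by (simp add: algebra_simps)
  finally show ?case .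
qed simp

text \<open>The linear terms cancel, so only the powers from the square on contribute. On the ball of radius
  \<open>r\<close> the \<open>k\<close>-th power has Lipschitz constant \<open>k r\<^bsup>k-1\<^esup>\<close>, even for elements that do not commute, and
  weighted by \<open>1/k!\<close> these constants add up to \<open>e\<^sup>r - 1\<close>.\<close>

lemma exp_minus_id_Lipschitz:
  fixes y z :: "'a::{real_normed_algebra_1,banach}"
  assumes "norm y \<le> r" "norm z \<le> r"
  shows "norm ((exp y - y) - (exp z - z)) \<le> (exp r - 1) * norm (y - z)"
proof -
  have tail: "(\<lambda>k. x ^ (k + 2) /\<^sub>R fact (k + 2)) sums (exp x - x - 1)"
    for x :: "'b::{real_normed_algebra_1,banach}"
    using sums_split_initial_segment[OF exp_converges[of x], of 2]
    by (simp add: numeral_2_eq_2 algebra_simps)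
  have "(\<lambda>k. y ^ (k + 2) /\<^sub>R fact (k + 2) - z ^ (k + 2) /\<^sub>R fact (k + 2)) sums
      ((exp y - y) - (exp z - z))"
    using sums_diff[OF tail tail, of y z] by (simp add: algebra_simps)
  moreover have "(\<lambda>k. r ^ (k + 1) /\<^sub>R fact (k + 1) * norm (y - z)) sums
      ((exp r - 1) * norm (y - z))"
    using sums_split_initial_segment[OF exp_converges[of r], of 1]
    by (intro sums_mult2) simp
  moreover have "norm (y ^ (k + 2) /\<^sub>R fact (k + 2) - z ^ (k + 2) /\<^sub>R fact (k + 2))
      \<le> r ^ (k + 1) /\<^sub>R fact (k + 1) * norm (y - z)" for k
  proof -
    have "norm (y ^ (k + 2) /\<^sub>R fact (k + 2) - z ^ (k + 2) /\<^sub>R fact (k + 2))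
        = norm (y ^ Suc (k + 1) - z ^ Suc (k + 1)) / fact (k + 2)"
      by (simp add: scaleR_diff_right[symmetric] divide_inverse del: power_Suc)
    also have "\<dots> \<le> (real (Suc (k + 1)) * r ^ (k + 1) * norm (y - z)) / fact (k + 2)"
      by (intro divide_right_mono norm_diff_power_le assms) simp
    also have "\<dots> = r ^ (k + 1) /\<^sub>R fact (k + 1) * norm (y - z)"
      by (simp add: divide_simps fact_reduce[of "k+2"])
    finally show ?thesis .
  qed
  ultimately show ?thesis
    by (rule norm_sums_le)
qed

text \<open>The radius \<open>1/4\<close> is one for which \<open>e\<^sup>r - 1 \<le> 1/2\<close>. It is the meaning of ``small'' in the rest of
  this section.\<close>

lemma exp_minus_id_contraction:
  fixes y z :: "'a::{real_normed_algebra_1,banach}"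
  assumes "norm y \<le> 1/4" "norm z \<le> 1/4"
  shows "norm ((exp y - y) - (exp z - z)) \<le> 1/2 * norm (y - z)"
proof -
  have "exp (1/4 :: real) \<le> 3/2"
    using exp_bound[of "1/4"] by (simp add: power2_eq_square)
  then have "(exp (1/4) - 1) * norm (y - z) \<le> 1/2 * norm (y - z)"
    by (intro mult_right_mono) auto
  then show ?thesis
    using exp_minus_id_Lipschitz[OF assms] by linarith
qed

lemma exp_eq_imp_eq_if_small:
  fixes y z :: "'a::{real_normed_algebra_1,banach}"
  assumes "norm y \<le> 1/4" "norm z \<le> 1/4" "exp y = exp z"
  shows "y = z"
  using exp_minus_id_contraction[OF assms(1,2)] assms(3) by (simp add: norm_minus_commute)

lemma norm_exp_minus_one_le:
  fixes y :: "'a::{real_normed_algebra_1,banach}"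
  assumes "norm y \<le> 1/4"
  shows "norm (exp y - 1) \<le> 3/2 * norm y"
  using exp_minus_id_contraction[OF assms, of 0] norm_triangle_ineq[of "exp y - y - 1" y]
  by simp

lemma exp_commutes:
  fixes y w :: "'a::{real_normed_algebra_1,banach}"
  assumes "w * y = y * w"
  shows "w * exp y = exp y * w"
proof -
  have "w * y ^ k = y ^ k * w" for k
    by (induction k) (simp, metis assms mult.assoc power_Suc)
  moreover have "(\<lambda>k. w * (y ^ k /\<^sub>R fact k)) sums (w * exp y)"
    by (intro bounded_linear.sums[OF bounded_linear_mult_right] exp_converges)
  moreover have "(\<lambda>k. (y ^ k /\<^sub>R fact k) * w) sums (exp y * w)"
    by (intro bounded_linear.sums[OF bounded_linear_mult_left] exp_converges)
  ultimately show ?thesis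
    by (simp add: sums_iff)
qed

text \<open>The logarithm is the fixed point of the contraction \<open>y \<mapsto> y + x - exp y\<close>. Carrying out the
  iteration inside the bicommutant of \<open>x\<close>, which is closed and invariant under this map, makes the
  logarithm commute with everything that commutes with \<open>x\<close>.\<close>

lemma small_log_exists:
  fixes x :: "'a::{real_normed_algebra_1,banach}"
  assumes x: "norm (x - 1) \<le> 1/8"
  obtains y where "exp y = x" "norm y \<le> 1/4" "norm y \<le> 2 * norm (x - 1)"
    "\<And>w. w * x = x * w \<Longrightarrow> w * y = y * w"
proof -
  \<comment> \<open>The bicommutant of \<open>x\<close>.\<close>
  define B where "B = (\<Inter>w\<in>{w. w * x = x * w}. {y. w * y = y * w})"
  let ?S = "cball 0 (1/4) \<inter> B"
  have "closed B"
    unfolding B_def by (intro closed_INT ballI closed_Collect_eq continuous_intros)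
  then have "complete ?S"
    by (simp add: complete_eq_closed closed_Int)
  moreover have "0 \<in> ?S"
    by (auto simp: B_def)
  then have "?S \<noteq> {}"
    by blast
  moreover have "(\<lambda>y. y + x - exp y) ` ?S \<subseteq> ?S"
  proof (rule image_subsetI)
    fix y assume y: "y \<in> ?S"
    have "norm (y + x - exp y) = norm ((x - 1) - ((exp y - y) - (exp 0 - 0)))"
      by (simp add: algebra_simps)
    also have "\<dots> \<le> norm (x - 1) + norm ((exp y - y) - (exp 0 - 0))"
      by (rule norm_triangle_ineq4)
    also have "\<dots> \<le> 1/4"
      using y x exp_minus_id_contraction[of y 0] by simp
    finally show "y + x - exp y \<in> ?S"
      using y by (auto simp: B_def algebra_simps exp_commutes)
  qed
  moreover have "dist (y + x - exp y) (z + x - exp z) \<le> 1/2 * dist y z"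
    if "y \<in> ?S" "z \<in> ?S" for y z
    using that exp_minus_id_contraction[of z y]
    by (simp add: dist_norm algebra_simps norm_minus_commute)
  ultimately have "\<exists>!y\<in>?S. y + x - exp y = y"
    by (intro Banach_fix[where c = "1/2"]) simp_all
  then obtain y where y: "y \<in> ?S" "y + x - exp y = y"
    by auto
  then have e: "exp y = x"
    by (simp add: algebra_simps)
  have "norm y \<le> norm (exp y - 1) + norm ((exp y - y) - (exp 0 - 0))"
    using norm_triangle_ineq4[of "exp y - 1" "(exp y - y) - (exp 0 - 0)"] by simp
  also have "\<dots> \<le> norm (x - 1) + 1/2 * norm y"
    using y(1) e exp_minus_id_contraction[of y 0] by simp
  finally have "norm y \<le> 2 * norm (x - 1)"
    by simp
  with y e show thesis
    by (intro that[of y]) (auto simp: B_def)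
qed

section \<open>Polynomials in an algebra element\<close>

lemma scaleC_zero_left [simp]: "0 *\<^sub>C (x::'a::cstar_algebra) = 0"
  using scaleR_scaleC[of 0 x] by simp

lemma scaleC_one [simp]: "1 *\<^sub>C (x::'a::cstar_algebra) = x"
  using scaleR_scaleC[of 1 x] by simp

lemma scaleC_minus_left: "(- z) *\<^sub>C (x::'a::cstar_algebra) = - (z *\<^sub>C x)"
  using scaleC_add_left[of "-z" z x] by (simp add: eq_neg_iff_add_eq_0)

lemma scaleC_zero_right [simp]: "z *\<^sub>C (0::'a::cstar_algebra) = 0"
  using scaleC_add_right[of z 0 0] by simp

lemma scaleC_minus_right: "z *\<^sub>C (- x) = - (z *\<^sub>C (x::'a::cstar_algebra))"
  using scaleC_add_right[of z x "-x"] by (simp add: eq_neg_iff_add_eq_0 add.commute)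

lemma alg_poly_0 [simp]: "alg_poly 0 a = 0"
  by (simp add: alg_poly_def)

lemma alg_poly_pCons: "alg_poly (pCons c q) a = c *\<^sub>C 1 + a * alg_poly q a"
proof (cases "q = 0")
  case False
  then show ?thesis
    by (simp add: alg_poly_def sum.atMost_Suc_shift sum_distrib_left mult_scaleC_right
        del: sum.atMost_Suc)
qed (simp add: alg_poly_def)

lemma alg_poly_1 [simp]: "alg_poly 1 a = 1"
  by (simp add: one_pCons alg_poly_pCons)

lemma alg_poly_add: "alg_poly (p + q) a = alg_poly p a + alg_poly q a"
  by (induction p q rule: poly_induct2) (auto simp: alg_poly_pCons scaleC_add_left algebra_simps)

lemma alg_poly_smult: "alg_poly (smult c q) a = c *\<^sub>C alg_poly q a"
  by (induction q) (auto simp: alg_poly_pCons scaleC_add_right scaleC_scaleC mult_scaleC_right)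

lemma alg_poly_mult: "alg_poly (p * q) a = alg_poly p a * alg_poly q a"
  by (induction p)
    (auto simp: alg_poly_pCons alg_poly_add alg_poly_smult mult_scaleC_left algebra_simps)

lemma alg_poly_commutes: "a * alg_poly q a = alg_poly q a * a"
  using alg_poly_mult[of "[:0, 1:]" q a] alg_poly_mult[of q "[:0, 1:]" a]
  by (simp add: alg_poly_pCons mult.commute)

lemma alg_poly_intertwine:
  assumes "a * s = s * b"
  shows "alg_poly q a * s = s * alg_poly q b"
proof (induction q)
  case (pCons c q)
  have "a * alg_poly q a * s = a * s * alg_poly q b"
    by (simp add: mult.assoc pCons.IH)
  then show ?case
    by (simp add: alg_poly_pCons algebra_simps mult_scaleC_left mult_scaleC_right mult.assoc assms)
qed simp

lemma continuous_on_alg_poly [continuous_intros]: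
  "continuous_on S (\<lambda>y. alg_poly q y)"
  by (induction q) (auto simp: alg_poly_pCons intro!: continuous_intros)

text \<open>For fixed \<open>x\<close> the quotient \<open>P = P\<^sub>q\<close> is built by Horner's scheme: if \<open>P\<^sub>q\<close> works for \<open>q\<close>, then
  \<open>q(y) + x P\<^sub>q(y)\<close> works for \<open>c + X q\<close>. At \<open>y = x\<close> this recursion is that of the derivative,
  \<open>(c + X q)' = q + X q'\<close>.\<close>

lemma noncommutative_difference_quotient:
  fixes x :: "'a::cstar_algebra"
  obtains P where "\<And>y. x * P y - P y * y = alg_poly q x - alg_poly q y"
    "P x = alg_poly (pderiv q) x" "continuous_on UNIV P"
proof -
  have "\<exists>P. (\<forall>y. x * P y - P y * y = alg_poly q x - alg_poly q y) \<and>
      P x = alg_poly (pderiv q) x \<and> continuous_on UNIV P"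
  proof (induction q)
    case 0
    show ?case
      by (rule exI[of _ "\<lambda>y. 0"]) auto
  next
    case (pCons c q)
    then obtain P where P: "\<And>y. x * P y - P y * y = alg_poly q x - alg_poly q y"
      "P x = alg_poly (pderiv q) x" "continuous_on UNIV P"
      by blast
    have "x * (alg_poly q y + x * P y) - (alg_poly q y + x * P y) * y
        = alg_poly (pCons c q) x - alg_poly (pCons c q) y" for y
    proof -
      have "x * (alg_poly q y + x * P y) - (alg_poly q y + x * P y) * y
        = x * alg_poly q y - alg_poly q y * y + x * (x * P y - P y * y)"
        by (simp add: algebra_simps)
      then show ?thesis
        by (simp add: P(1) alg_poly_pCons alg_poly_commutes[of y] algebra_simps)
    qed
    moreover have "alg_poly q x + x * P x = alg_poly (pderiv (pCons c q)) x"
      by (simp add: pderiv_pCons alg_poly_add alg_poly_pCons P(2))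
    moreover have "continuous_on UNIV (\<lambda>y. alg_poly q y + x * P y)"
      by (intro continuous_intros P(3))
    ultimately show ?case
      by (intro exI[of _ "\<lambda>y. alg_poly q y + x * P y"]) simp
  qed
  with that show thesis
    by blast
qed

text \<open>A Bezout identity \<open>r q + s q' = 1\<close> evaluated at the root \<open>a\<close> shows that \<open>s(a)\<close> is a left inverse of
  \<open>q'(a) = P(a)\<close>. Since \<open>s(a)\<close> commutes with \<open>a\<close>, the element \<open>v = s(a) P(b)\<close> intertwines \<open>a\<close> and \<open>b\<close>
  just as \<open>P(b)\<close> does, and by continuity of \<open>P\<close> it is close to \<open>s(a) P(a) = 1\<close>.\<close>

lemma intertwiner_near_one:
  fixes a :: "'a::cstar_algebra"
  assumes cop: "coprime q (pderiv q)" and a: "alg_poly q a = 0" and "\<epsilon> > 0"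
  obtains \<delta> where "\<delta> > 0"
    "\<And>b. alg_poly q b = 0 \<Longrightarrow> dist b a < \<delta> \<Longrightarrow> \<exists>v. a * v = v * b \<and> norm (v - 1) < \<epsilon>"
proof -
  obtain P where P: "\<And>y. a * P y - P y * y = alg_poly q a - alg_poly q y"
      "P a = alg_poly (pderiv q) a" "continuous_on UNIV P"
    using noncommutative_difference_quotient[of a q] by blast
  obtain r s where "r * q + s * pderiv q = 1"
    using bezout_coefficients_fst_snd[of q "pderiv q"] cop by auto
  then have "alg_poly (r * q + s * pderiv q) a = 1"
    by simp
  then have inv: "alg_poly s a * P a = 1"
    by (simp add: alg_poly_add alg_poly_mult a P(2))
  have "continuous_on UNIV (\<lambda>y. alg_poly s a * P y)"
    by (intro continuous_intros P(3))
  then obtain \<delta> where \<delta>: "\<delta> > 0"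
      "\<And>b. dist b a < \<delta> \<Longrightarrow> dist (alg_poly s a * P b) (alg_poly s a * P a) < \<epsilon>"
    using \<open>\<epsilon> > 0\<close> unfolding continuous_on_iff by (metis UNIV_I)
  have "a * (alg_poly s a * P b) = (alg_poly s a * P b) * b" if "alg_poly q b = 0" for b
  proof -
    have "a * (alg_poly s a * P b) = alg_poly s a * (a * P b)"
      by (metis alg_poly_commutes mult.assoc)
    also have "a * P b = P b * b"
      using P(1)[of b] a that by simp
    finally show ?thesis
      by (simp add: mult.assoc)
  qed
  with \<delta> show thesis
    by (intro that[of \<delta>]) (auto simp: inv dist_norm)
qed

text \<open>A common divisor that is not constant has a complex root; it would be a zero \<open>\<lambda>\<^sub>j\<close> of the product
  at which the derivative, the product of the \<open>\<lambda>\<^sub>j - \<lambda>\<^sub>i\<close> over \<open>i \<noteq> j\<close>, vanishes too.\<close>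

lemma coprime_pderiv_prod_linear:
  fixes lam :: "'i \<Rightarrow> complex"
  assumes "finite I" "inj_on lam I"
  shows "coprime (\<Prod>i\<in>I. [:- lam i, 1:]) (pderiv (\<Prod>i\<in>I. [:- lam i, 1:]))"
    (is "coprime ?p _")
proof (rule coprimeI)
  fix d
  assume d: "d dvd ?p" "d dvd pderiv ?p"
  have "poly d z \<noteq> 0" for z
  proof
    assume "poly d z = 0"
    with d have z: "poly ?p z = 0" "poly (pderiv ?p) z = 0"
      by (metis dvdE mult_zero_left poly_mult)+
    then obtain j where j: "j \<in> I" "z = lam j"
      using \<open>finite I\<close> by (auto simp: poly_prod)
    have "?p = [:- lam j, 1:] * (\<Prod>i\<in>I - {j}. [:- lam i, 1:])"
      using j \<open>finite I\<close> by (simp add: prod.remove)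
    then have "pderiv ?p = [:- lam j, 1:] * pderiv (\<Prod>i\<in>I - {j}. [:- lam i, 1:])
        + (\<Prod>i\<in>I - {j}. [:- lam i, 1:]) * pderiv [:- lam j, 1:]"
      by (simp only: pderiv_mult)
    with z j have "poly (\<Prod>i\<in>I - {j}. [:- lam i, 1:]) (lam j) = 0"
      by (simp add: pderiv_pCons)
    then show False
      using j assms by (auto simp: poly_prod inj_on_def)
  qed
  then have "constant (poly d)"
    using fundamental_theorem_of_algebra by blast
  then have "degree d = 0"
    by (simp add: constant_degree)
  moreover have "d \<noteq> 0"
    using \<open>\<And>z. poly d z \<noteq> 0\<close> by auto
  ultimately show "is_unit d"
    by (simp add: is_unit_iff_degree)
qed

section \<open>The involution, and unitaries near 1\<close>

lemma adj_0 [simp]: "adj (0::'a::cstar_algebra) = 0"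
  using adj_add[of "0::'a" 0] by simp

lemma adj_1 [simp]: "adj (1::'a::cstar_algebra) = 1"
  by (metis adj_adj adj_mult mult_1_left)

lemma adj_minus [simp]: "adj (- x) = - adj (x::'a::cstar_algebra)"
  using adj_add[of x "- x"] by (simp add: eq_neg_iff_add_eq_0 add.commute)

lemma adj_diff: "adj (x - y) = adj x - adj (y::'a::cstar_algebra)"
  using adj_add[of x "- y"] by simp

lemma adj_scaleR: "adj (r *\<^sub>R x) = r *\<^sub>R adj (x::'a::cstar_algebra)"
  by (simp add: scaleR_scaleC adj_scaleC)

lemma adj_power: "adj (x ^ k) = adj (x::'a::cstar_algebra) ^ k"
  by (induction k) (auto simp: adj_mult power_commutes)

text \<open>The \<open>C\<^sup>*\<close>-identity gives \<open>\<parallel>y\<parallel>\<^sup>2 = \<parallel>y\<^sup>* y\<parallel> \<le> \<parallel>y\<^sup>*\<parallel> \<parallel>y\<parallel>\<close>. Isometry makes the involution continuous, so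
  that it can be applied to the exponential series term by term.\<close>

lemma norm_adj [simp]: "norm (adj x) = norm (x::'a::cstar_algebra)"
proof -
  have le: "norm y \<le> norm (adj y)" for y :: 'a
  proof (cases "y = 0")
    case False
    have "norm y * norm y \<le> norm (adj y) * norm y"
      using norm_mult_ineq[of "adj y" y] by (simp add: cstar_identity power2_eq_square)
    with False show ?thesis
      by simp
  qed simp
  show ?thesis
    using le[of x] le[of "adj x"] by (simp add: adj_adj)
qed

lemma bounded_linear_adj: "bounded_linear (adj :: 'a::cstar_algebra \<Rightarrow> 'a)"
  by (rule bounded_linear_intro[where K = 1]) (auto simp: adj_add adj_scaleR)

lemma adj_exp: "adj (exp x) = exp (adj (x::'a::cstar_algebra))"
proof -
  have "(\<lambda>k. adj (x ^ k /\<^sub>R fact k)) sums adj (exp x)"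
    by (intro bounded_linear.sums[OF bounded_linear_adj] exp_converges)
  then show ?thesis
    using exp_converges[of "adj x"] by (simp add: adj_scaleR adj_power sums_iff)
qed

lemma exp_minus_inverse_left: "exp (- x) * exp (x::'a::{real_normed_algebra_1,banach}) = 1"
  using exp_minus_inverse[of "- x"] by simp

lemma unitary_exp_if_skew:
  assumes "adj y = - y"
  shows "unitary (exp y)"
  by (simp add: unitary_def adj_exp assms exp_minus_inverse exp_minus_inverse_left)

text \<open>If \<open>y\<close> is the small logarithm of \<open>u\<close>, then \<open>y\<^sup>*\<close> and \<open>- y\<close> are both small logarithms of
  \<open>u\<^sup>* = u\<^sup>-\<^sup>1\<close>, hence equal.\<close>

lemma unitary_near_one_eq_exp:
  fixes u :: "'a::cstar_algebra"
  assumes "unitary u" "norm (u - 1) \<le> 1/8"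
  obtains y where "adj y = - y" "exp y = u"
proof -
  obtain y where y: "exp y = u" "norm y \<le> 1/4"
    using small_log_exists assms(2) by blast
  have "exp (adj y) = exp (adj y) * exp y * exp (- y)"
    by (simp add: mult.assoc exp_minus_inverse)
  also have "\<dots> = exp (- y)"
    using assms(1) y by (simp add: unitary_def flip: adj_exp)
  finally have "exp (adj y) = exp (- y)" .
  with y(2) have "adj y = - y"
    by (simp add: exp_eq_imp_eq_if_small)
  with y that show thesis
    by blast
qed

text \<open>Here \<open>h = (v\<^sup>* v)\<^sup>-\<^sup>1\<^sup>/\<^sup>2\<close>, obtained as \<open>exp (- l / 2)\<close> from the small logarithm \<open>l\<close> of \<open>v\<^sup>* v\<close>. The bound
  \<open>1/8\<close> on \<open>v h - 1\<close> is what \<open>unitary_near_one_eq_exp\<close> asks for, and \<open>1/100\<close> is small enough to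
  guarantee it.\<close>

lemma polar_near_one:
  fixes v :: "'a::cstar_algebra"
  assumes v: "norm (v - 1) \<le> 1/100"
  obtains h where "unitary (v * h)" "norm (v * h - 1) \<le> 1/8"
    "\<And>w. w * (adj v * v) = (adj v * v) * w \<Longrightarrow> w * h = h * w"
proof -
  have nv: "norm v \<le> 101/100"
    using v norm_triangle_ineq[of "v - 1" 1] by simp
  have "norm (adj v * v - 1) = norm (adj v * (v - 1) + adj (v - 1))"
    by (simp add: algebra_simps adj_diff)
  also have "\<dots> \<le> norm (adj v) * norm (v - 1) + norm (adj (v - 1))"
    by (intro norm_triangle_mono norm_mult_ineq order_refl)
  also have "\<dots> \<le> 101/100 * (1/100) + 1/100"
    using v nv by (intro add_mono mult_mono) (simp_all only: norm_adj norm_ge_zero)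
  finally have vv: "norm (adj v * v - 1) \<le> 3/100"
    by simp
  obtain l where l: "exp l = adj v * v" "norm l \<le> 1/4" "norm l \<le> 2 * norm (adj v * v - 1)"
    and l_comm: "\<And>w. w * (adj v * v) = (adj v * v) * w \<Longrightarrow> w * l = l * w"
    using small_log_exists[of "adj v * v"] vv by auto
  have "exp (adj l) = exp l"
    by (simp add: l(1) adj_mult adj_adj flip: adj_exp)
  with l(2) have l_adj: "adj l = l"
    by (simp add: exp_eq_imp_eq_if_small)
  define h where "h = exp (- ((1/2) *\<^sub>R l))"
  have h_adj: "adj h = h"
    by (simp add: h_def adj_exp adj_scaleR l_adj)
  have h_comm: "w * h = h * w" if "w * (adj v * v) = (adj v * v) * w" for w
    unfolding h_def by (rule exp_commutes) (use l_comm[OF that] in simp)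
  have "- ((1/2) *\<^sub>R l) + - ((1/2) *\<^sub>R l) = - l"
    by (simp only: minus_add_distrib[symmetric] scaleR_add_left[symmetric]) simp
  then have hh: "h * h = exp (- l)"
    unfolding h_def by (metis exp_add_commuting)
  have uu: "adj (v * h) * (v * h) = 1"
  proof -
    have "adj (v * h) * (v * h) = h * (adj v * v) * h"
      by (simp add: adj_mult h_adj mult.assoc)
    also have "\<dots> = adj v * v * (h * h)"
      by (simp add: h_comm[of "adj v * v", symmetric] mult.assoc)
    also have "\<dots> = 1"
      by (simp add: hh exp_minus_inverse flip: l(1))
    finally show ?thesis .
  qed
  \<comment> \<open>Being an exponential, \<open>v\<close> is invertible; so is \<open>v h\<close>, and its left inverse \<open>(v h)\<^sup>*\<close> is two-sided.\<close>
  obtain w where w: "exp w = v"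
    using small_log_exists[of v] v by auto
  define k where "k = exp ((1/2) *\<^sub>R l) * exp (- w)"
  have "v * h * k = v * (h * exp ((1/2) *\<^sub>R l)) * exp (- w)"
    by (simp add: k_def mult.assoc)
  also have "\<dots> = 1"
    by (simp add: h_def exp_minus_inverse_left exp_minus_inverse flip: w)
  finally have "v * h * k = 1" .
  then have "adj (v * h) = k"
    by (metis uu mult.assoc mult_1_left mult_1_right)
  with uu \<open>v * h * k = 1\<close> have "unitary (v * h)"
    by (simp add: unitary_def)
  moreover have "norm (v * h - 1) \<le> 1/8"
  proof -
    have "norm (h - 1) \<le> 3/2 * norm (- ((1/2) *\<^sub>R l))"
      unfolding h_def using l(2) by (intro norm_exp_minus_one_le) simp
    also have "\<dots> \<le> 9/200"
      using l(3) vv by simp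
    finally have h1: "norm (h - 1) \<le> 9/200" .
    have "norm (v * h - 1) = norm (v * (h - 1) + (v - 1))"
      by (simp add: algebra_simps)
    also have "\<dots> \<le> norm v * norm (h - 1) + norm (v - 1)"
      by (intro norm_triangle_mono norm_mult_ineq order_refl)
    also have "\<dots> \<le> 101/100 * (9/200) + 1/100"
      using v nv h1 by (intro add_mono mult_mono) (simp_all only: norm_ge_zero)
    finally show ?thesis
      by simp
  qed
  ultimately show thesis
    using that h_comm by blast
qed

section \<open>Nearby roots are conjugate\<close>

text \<open>The intertwiner \<open>v\<close> of \<open>a\<close> and \<open>b\<close> is replaced by its unitary part \<open>v h\<close>, which still intertwines
  because \<open>v\<^sup>* v\<close> commutes with \<open>b\<close>: from \<open>a v = v b\<close> and its adjoint \<open>v\<^sup>* a = b v\<^sup>*\<close> follows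
  \<open>b v\<^sup>* v = v\<^sup>* a v = v\<^sup>* v b\<close>. As \<open>v h\<close> is close to \<open>1\<close>, it is an exponential.\<close>

lemma nearby_roots_conjugate:
  fixes a :: "'a::cstar_algebra"
  assumes cop: "coprime q (pderiv q)" and a: "a \<in> sa_roots q"
  obtains \<delta> where "\<delta> > 0"
    "\<And>b. b \<in> sa_roots q \<Longrightarrow> dist b a < \<delta> \<Longrightarrow>
      \<exists>c. selfadjoint c \<and> b = exp (- (\<i> *\<^sub>C c)) * a * exp (\<i> *\<^sub>C c)"
proof -
  obtain \<delta> where \<delta>: "\<delta> > 0"
    "\<And>b. alg_poly q b = 0 \<Longrightarrow> dist b a < \<delta> \<Longrightarrow> \<exists>v. a * v = v * b \<and> norm (v - 1) < 1/100"
    using intertwiner_near_one[OF cop, of a "1/100"] a by (auto simp: sa_roots_def)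
  have "\<exists>c. selfadjoint c \<and> b = exp (- (\<i> *\<^sub>C c)) * a * exp (\<i> *\<^sub>C c)"
    if b: "b \<in> sa_roots q" "dist b a < \<delta>" for b
  proof -
    obtain v where v: "a * v = v * b" "norm (v - 1) < 1/100"
      using \<delta>(2) b by (auto simp: sa_roots_def)
    have sa: "adj a = a" "adj b = b"
      using a b by (auto simp: sa_roots_def selfadjoint_def)
    have "adj v * a = b * adj v"
      using arg_cong[OF v(1), of adj] by (simp add: adj_mult sa)
    then have bv: "b * (adj v * v) = (adj v * v) * b"
      by (metis v(1) mult.assoc)
    obtain h where h: "unitary (v * h)" "norm (v * h - 1) \<le> 1/8"
      "\<And>w. w * (adj v * v) = (adj v * v) * w \<Longrightarrow> w * h = h * w"
      using polar_near_one[of v] v(2) by auto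
    obtain y where y: "adj y = - y" "exp y = v * h"
      using unitary_near_one_eq_exp h by blast
    define c where "c = (- \<i>) *\<^sub>C y"
    have c: "\<i> *\<^sub>C c = y" "selfadjoint c"
      by (simp_all add: c_def scaleC_scaleC selfadjoint_def adj_scaleC y scaleC_minus_left
          scaleC_minus_right)
    have "a * exp y = exp y * b"
      by (metis y(2) h(3)[OF bv] v(1) mult.assoc)
    then have "b = exp (- y) * a * exp y"
      by (simp add: mult.assoc) (simp add: exp_minus_inverse_left flip: mult.assoc)
    with c show ?thesis
      by auto
  qed
  with \<delta> that show thesis
    by blast
qed

section \<open>Products of unitary exponentials\<close>

lemma unitary_mult: "unitary s \<Longrightarrow> unitary t \<Longrightarrow> unitary (s * t)"
proof -
  assume s: "unitary s" and t: "unitary t"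
  have "adj (s * t) * (s * t) = adj t * (adj s * s) * t" "s * t * adj (s * t) = s * (t * adj t) * adj s"
    by (simp_all add: adj_mult mult.assoc)
  with s t show ?thesis
    by (simp add: unitary_def)
qed

lemma unitary_conj_in_sa_roots:
  assumes "a \<in> sa_roots q" "unitary s"
  shows "adj s * a * s \<in> sa_roots q"
proof -
  have s: "adj s * s = 1" "s * adj s = 1"
    using assms(2) by (auto simp: unitary_def)
  have "a * s = s * (adj s * a * s)"
    by (simp add: mult.assoc[symmetric] s)
  then have "s * alg_poly q (adj s * a * s) = 0"
    using alg_poly_intertwine[of a s "adj s * a * s" q] assms(1) by (simp add: sa_roots_def)
  then have "alg_poly q (adj s * a * s) = 0"
    by (metis s(1) mult.assoc mult_1_left mult_zero_right)
  with assms(1) show ?thesis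
    by (simp add: sa_roots_def selfadjoint_def adj_mult adj_adj mult.assoc)
qed

lemma mult_inv_unitary:
  assumes "unitary s"
  shows "mult_inv s = adj s"
  unfolding mult_inv_def
proof (rule the_equality)
  show "adj s * s = 1 \<and> s * adj s = 1"
    using assms by (simp add: unitary_def)
  show "r = adj s" if "r * s = 1 \<and> s * r = 1" for r
    using that assms by (metis unitary_def mult.assoc mult_1_left mult_1_right)
qed

text \<open>The parameter is kept as a real scalar outside \<open>i c\<close>, so that the theory of the one-parameter
  groups \<open>t \<mapsto> exp (t d)\<close> in real Banach algebras applies to each factor.\<close>

definition exp_prod :: "real \<Rightarrow> 'a::cstar_algebra list \<Rightarrow> 'a" where
  "exp_prod t cs = prod_list (map (\<lambda>c. exp (t *\<^sub>R (\<i> *\<^sub>C c))) cs)"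

lemma exp_prod_Nil [simp]: "exp_prod t [] = 1"
  and exp_prod_Cons: "exp_prod t (c # cs) = exp (t *\<^sub>R (\<i> *\<^sub>C c)) * exp_prod t cs"
  and exp_prod_append: "exp_prod t (cs @ ds) = exp_prod t cs * exp_prod t ds"
  by (simp_all add: exp_prod_def)

lemma exp_prod_0 [simp]: "exp_prod 0 cs = 1"
  by (induction cs) (auto simp: exp_prod_Cons)

lemma selfadjoint_skew: "selfadjoint c \<Longrightarrow> adj (t *\<^sub>R (\<i> *\<^sub>C c)) = - (t *\<^sub>R (\<i> *\<^sub>C c))"
  by (simp add: selfadjoint_def adj_scaleR adj_scaleC scaleC_minus_left)

lemma adj_exp_prod:
  "(\<And>c. c \<in> set cs \<Longrightarrow> selfadjoint c) \<Longrightarrow> adj (exp_prod t cs) = exp_prod (- t) (rev cs)"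
  by (induction cs) (auto simp: exp_prod_Cons exp_prod_append adj_mult adj_exp selfadjoint_skew)

lemma unitary_exp_prod:
  "(\<And>c. c \<in> set cs \<Longrightarrow> selfadjoint c) \<Longrightarrow> unitary (exp_prod t cs)"
  by (induction cs)
    (auto simp: exp_prod_Cons unitary_def[of 1] intro!: unitary_mult unitary_exp_if_skew selfadjoint_skew)

lemma continuous_on_exp_prod: "continuous_on T (\<lambda>t. exp_prod t cs)"
proof (induction cs)
  case (Cons c cs)
  have "continuous_on T (\<lambda>t. exp (t *\<^sub>R (\<i> *\<^sub>C c)))"
    using exp_scaleR_has_vector_derivative_right has_vector_derivative_continuous
    by (intro continuous_at_imp_continuous_on ballI) blast
  with Cons.IH show ?case
    by (simp add: exp_prod_Cons continuous_intros)
qed simp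

text \<open>The path \<open>t \<mapsto> (exp_prod t cs)\<^sup>* a (exp_prod t cs)\<close> is continuous, consists of roots, and passes
  through \<open>a\<close> at \<open>t = 0\<close>.\<close>

lemma exp_prod_conj_in_component:
  assumes C: "C \<in> components (sa_roots q)" and a: "a \<in> C"
    and cs: "\<And>c. c \<in> set cs \<Longrightarrow> selfadjoint c"
  shows "adj (exp_prod t cs) * a * exp_prod t cs \<in> C"
proof -
  let ?a = "\<lambda>t. adj (exp_prod t cs) * a * exp_prod t cs"
  have "continuous_on UNIV ?a"
    by (intro continuous_intros continuous_on_exp_prod bounded_linear.continuous_on[OF bounded_linear_adj])
  then have "connected (range ?a)"
    by (intro connected_continuous_image connected_UNIV)
  moreover have "range ?a \<subseteq> sa_roots q"
    using a in_components_subset[OF C] cs by (auto intro!: unitary_conj_in_sa_roots unitary_exp_prod)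
  moreover have "a \<in> range ?a"
    by (rule image_eqI[of _ _ 0]) simp_all
  ultimately have "range ?a \<subseteq> C"
    using components_maximal[OF C] a by blast
  then show ?thesis
    by blast
qed

section \<open>Components of the set of roots\<close>

lemma exp_prod_singleton: "exp_prod 1 [c] = exp (\<i> *\<^sub>C c)"
  by (simp add: exp_prod_def)

lemma nearby_roots_in_component:
  fixes a :: "'a::cstar_algebra"
  assumes cop: "coprime q (pderiv q)" and C: "C \<in> components (sa_roots q)" and a: "a \<in> C"
  obtains \<delta> where "\<delta> > 0"
    "\<And>b. b \<in> sa_roots q \<Longrightarrow> dist b a < \<delta> \<Longrightarrow>
      b \<in> C \<and> (\<exists>c. selfadjoint c \<and> b = adj (exp_prod 1 [c]) * a * exp_prod 1 [c])"
proof -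
  obtain \<delta> where \<delta>: "\<delta> > 0"
    "\<And>b. b \<in> sa_roots q \<Longrightarrow> dist b a < \<delta> \<Longrightarrow>
      \<exists>c. selfadjoint c \<and> b = exp (- (\<i> *\<^sub>C c)) * a * exp (\<i> *\<^sub>C c)"
    using nearby_roots_conjugate[OF cop, of a] a in_components_subset[OF C] by blast
  show thesis
  proof (rule that[OF \<delta>(1)])
    fix b :: 'a
    assume "b \<in> sa_roots q" "dist b a < \<delta>"
    then obtain c where c: "selfadjoint c" "b = exp (- (\<i> *\<^sub>C c)) * a * exp (\<i> *\<^sub>C c)"
      using \<delta>(2) by blast
    have "b = adj (exp_prod 1 [c]) * a * exp_prod 1 [c]"
      using c selfadjoint_skew[OF c(1), of 1] by (simp add: exp_prod_singleton adj_exp)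
    moreover from this have "b \<in> C"
      using exp_prod_conj_in_component[OF C a, of "[c]" 1] c(1) by simp
    ultimately show "b \<in> C \<and> (\<exists>c. selfadjoint c \<and> b = adj (exp_prod 1 [c]) * a * exp_prod 1 [c])"
      using c(1) by blast
  qed
qed

lemma openin_component_sa_roots:
  assumes cop: "coprime q (pderiv q)" and C: "C \<in> components (sa_roots q)"
  shows "openin (top_of_set (sa_roots q)) C"
  unfolding openin_euclidean_subtopology_iff
proof (intro conjI ballI)
  show "C \<subseteq> sa_roots q"
    by (rule in_components_subset[OF C])
  show "\<exists>\<delta>>0. \<forall>b\<in>sa_roots q. dist b a < \<delta> \<longrightarrow> b \<in> C" if "a \<in> C" for a
    by (rule nearby_roots_in_component[OF cop C that]) blast
qed

text \<open>Being conjugate by a product of unitary exponentials is symmetric, since the inverse of such a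
  product is the product of the inverse factors in reverse order, and transitive by concatenation.
  All roots close to a point of \<open>C\<close> are conjugate to it by a single exponential, so connectedness
  of \<open>C\<close> makes any two of its points equivalent.\<close>

lemma component_conjugate:
  fixes a b :: "'a::cstar_algebra"
  assumes cop: "coprime q (pderiv q)" and C: "C \<in> components (sa_roots q)"
    and ab: "a \<in> C" "b \<in> C"
  shows "\<exists>cs. cs \<noteq> [] \<and> (\<forall>c\<in>set cs. selfadjoint c) \<and> b = adj (exp_prod 1 cs) * a * exp_prod 1 cs"
    (is "?R a b")
proof (rule connected_equivalence_relation[of C a b ?R])
  show "connected C"
    by (rule in_components_connected[OF C])
next
  fix x y
  assume "?R x y"
  then obtain cs where cs: "cs \<noteq> []" "\<And>c. c \<in> set cs \<Longrightarrow> selfadjoint c"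
    "y = adj (exp_prod 1 cs) * x * exp_prod 1 cs"
    by blast
  let ?ds = "rev (map uminus cs)"
  have sa: "selfadjoint c" if "c \<in> set ?ds" for c
    using that cs(2) by (auto simp: selfadjoint_def)
  have neg: "exp_prod (- 1) (map uminus ds) = exp_prod 1 ds" for ds :: "'a list"
    by (simp add: exp_prod_def o_def scaleC_minus_right)
  have "adj (exp_prod 1 ?ds) = exp_prod 1 cs"
    by (subst adj_exp_prod[OF sa]) (simp_all add: neg)
  then have e: "exp_prod 1 ?ds = adj (exp_prod 1 cs)" "adj (exp_prod 1 ?ds) = exp_prod 1 cs"
    by (metis adj_adj)+
  have "unitary (exp_prod 1 cs)"
    using cs(2) by (rule unitary_exp_prod)
  then have "exp_prod 1 cs * y * adj (exp_prod 1 cs) = x"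
    unfolding cs(3) unitary_def by (metis mult.assoc mult_1_left mult_1_right)
  then show "?R y x"
    using cs(1) sa by (intro exI[of _ ?ds]) (simp add: e adj_adj)
next
  fix x y z
  assume "?R x y" "?R y z"
  then obtain cs ds where
    "cs \<noteq> []" "\<And>c. c \<in> set cs \<Longrightarrow> selfadjoint c" "y = adj (exp_prod 1 cs) * x * exp_prod 1 cs"
    "\<And>c. c \<in> set ds \<Longrightarrow> selfadjoint c" "z = adj (exp_prod 1 ds) * y * exp_prod 1 ds"
    by blast
  then show "?R x z"
    by (intro exI[of _ "cs @ ds"]) (auto simp: exp_prod_append adj_mult mult.assoc)
next
  fix x
  assume x: "x \<in> C"
  obtain \<delta> where \<delta>: "\<delta> > 0"
    "\<And>y. y \<in> sa_roots q \<Longrightarrow> dist y x < \<delta> \<Longrightarrow>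
      y \<in> C \<and> (\<exists>c. selfadjoint c \<and> y = adj (exp_prod 1 [c]) * x * exp_prod 1 [c])"
    using nearby_roots_in_component[OF cop C x] by blast
  have "?R x y" if "y \<in> C \<inter> ball x \<delta>" for y
  proof -
    have "y \<in> sa_roots q" "dist y x < \<delta>"
      using that in_components_subset[OF C] by (auto simp: dist_commute)
    then obtain c where "selfadjoint c" "y = adj (exp_prod 1 [c]) * x * exp_prod 1 [c]"
      using \<delta>(2) by blast
    then show ?thesis
      by (intro exI[of _ "[c]"]) simp
  qed
  with x \<delta>(1) show "\<exists>T. openin (top_of_set C) T \<and> x \<in> T \<and> (\<forall>y\<in>T. ?R x y)"
    by (intro exI[of _ "C \<inter> ball x \<delta>"]) (auto simp: openin_open_Int)
qed (use ab in auto)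

section \<open>Analyticity of the path\<close>

text \<open>Absolute convergence is part of the definition so that the Cauchy product applies. All
  functions below are entire, so the expansion at \<open>x\<close> is required to converge on the whole line and
  no radius has to be tracked.\<close>

definition abs_power_series :: "(real \<Rightarrow> 'a::real_normed_vector) \<Rightarrow> real \<Rightarrow> bool" where
  "abs_power_series f x \<longleftrightarrow> (\<exists>u. \<forall>t.
     summable (\<lambda>k. norm ((t - x) ^ k *\<^sub>R u k)) \<and> (\<lambda>k. (t - x) ^ k *\<^sub>R u k) sums f t)"

lemma real_analytic_on_if_abs_power_series:
  "(\<And>x. abs_power_series f x) \<Longrightarrow> real_analytic_on f S"
  unfolding real_analytic_on_def abs_power_series_def by (meson zero_less_one)

lemma abs_power_series_const: "abs_power_series (\<lambda>t. a) x"
proof -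
  let ?u = "\<lambda>k::nat. if k = 0 then a else 0"
  have u: "(t - x) ^ k *\<^sub>R ?u k = (if k = 0 then a else 0)" for t k
    by simp
  have "summable (\<lambda>k. norm ((t - x) ^ k *\<^sub>R ?u k)) \<and> (\<lambda>k. (t - x) ^ k *\<^sub>R ?u k) sums a" for t
    unfolding u using sums_single[of 0 "\<lambda>_. a"] summable_single[of 0 "\<lambda>_. norm a"]
    by (simp add: if_distrib[of norm] eq_commute cong: if_cong)
  then show ?thesis
    unfolding abs_power_series_def by (intro exI[of _ ?u]) blast
qed

text \<open>The coefficients of the product are the convolutions of the coefficients; its series of norms is
  dominated by the Cauchy product of the two series of norms.\<close>

lemma abs_power_series_mult:
  fixes f g :: "real \<Rightarrow> 'a::{real_normed_algebra_1,banach}"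
  assumes "abs_power_series f x" "abs_power_series g x"
  shows "abs_power_series (\<lambda>t. f t * g t) x"
proof -
  obtain u where u: "\<And>t. summable (\<lambda>k. norm ((t - x) ^ k *\<^sub>R u k))"
    "\<And>t. (\<lambda>k. (t - x) ^ k *\<^sub>R u k) sums f t"
    using assms(1) unfolding abs_power_series_def by blast
  obtain v where v: "\<And>t. summable (\<lambda>k. norm ((t - x) ^ k *\<^sub>R v k))"
    "\<And>t. (\<lambda>k. (t - x) ^ k *\<^sub>R v k) sums g t"
    using assms(2) unfolding abs_power_series_def by blast
  define w where "w k = (\<Sum>i\<le>k. u i * v (k - i))" for k
  have w: "(\<Sum>i\<le>k. ((t - x) ^ i *\<^sub>R u i) * ((t - x) ^ (k - i) *\<^sub>R v (k - i))) = (t - x) ^ k *\<^sub>R w k"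
    for t k
    unfolding w_def scaleR_sum_right by (intro sum.cong) (auto simp flip: power_add)
  have "(\<lambda>k. (t - x) ^ k *\<^sub>R w k) sums (f t * g t)" for t
    using Cauchy_product_sums[OF u(1) v(1), of t t, unfolded w]
    unfolding sums_unique[OF u(2), symmetric] sums_unique[OF v(2), symmetric] .
  moreover have "summable (\<lambda>k. norm ((t - x) ^ k *\<^sub>R w k))" for t
  proof (rule summable_comparison_test')
    show "summable (\<lambda>k. \<Sum>i\<le>k. norm ((t - x) ^ i *\<^sub>R u i) * norm ((t - x) ^ (k - i) *\<^sub>R v (k - i)))"
      using u(1) v(1) by (intro summable_Cauchy_product) simp_all
    show "norm (norm ((t - x) ^ k *\<^sub>R w k)) \<le>
        (\<Sum>i\<le>k. norm ((t - x) ^ i *\<^sub>R u i) * norm ((t - x) ^ (k - i) *\<^sub>R v (k - i)))" for k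
      unfolding real_norm_def abs_norm_cancel w[symmetric] by (intro sum_norm_le norm_mult_ineq)
  qed
  ultimately show ?thesis
    unfolding abs_power_series_def by blast
qed

text \<open>\<open>exp (t d) = exp (x d) exp ((t - x) d)\<close> moves the centre of the exponential series to \<open>x\<close>.\<close>

lemma abs_power_series_exp:
  fixes d :: "'a::{real_normed_algebra_1,banach}"
  shows "abs_power_series (\<lambda>t. exp (t *\<^sub>R d)) x"
proof -
  let ?u = "\<lambda>k. d ^ k /\<^sub>R fact k"
  have eq: "(t - x) ^ k *\<^sub>R ?u k = ((t - x) *\<^sub>R d) ^ k /\<^sub>R fact k" for t k
    by simp
  have "abs_power_series (\<lambda>t. exp ((t - x) *\<^sub>R d)) x"
    unfolding abs_power_series_def
    by (intro exI[of _ ?u] allI conjI; unfold eq; rule summable_norm_exp exp_converges)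
  then have "abs_power_series (\<lambda>t. exp (x *\<^sub>R d) * exp ((t - x) *\<^sub>R d)) x"
    by (intro abs_power_series_mult abs_power_series_const)
  moreover have "exp (x *\<^sub>R d) * exp ((t - x) *\<^sub>R d) = exp (t *\<^sub>R d)" for t
    by (subst exp_add_commuting[symmetric]) (simp_all flip: scaleR_add_left)
  ultimately show ?thesis
    by simp
qed

lemma abs_power_series_prod_list:
  fixes f :: "'b \<Rightarrow> real \<Rightarrow> 'a::{real_normed_algebra_1,banach}"
  assumes "\<And>i. i \<in> set xs \<Longrightarrow> abs_power_series (f i) x"
  shows "abs_power_series (\<lambda>t. prod_list (map (\<lambda>i. f i t) xs)) x"
  using assms
proof (induction xs)
  case Nil
  show ?case
    using abs_power_series_const[of 1] by simp
next
  case (Cons i xs)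
  then have "abs_power_series (\<lambda>t. f i t * prod_list (map (\<lambda>i. f i t) xs)) x"
    by (intro abs_power_series_mult) simp_all
  then show ?case
    by simp
qed

section \<open>Components of the self-adjoint roots of a polynomial with distinct real zeros\<close>

theorem theorem12:
  fixes n :: nat and lam :: "nat \<Rightarrow> real" and p :: "complex poly"
    and C :: "'a::cstar_algebra set"
  assumes "n \<ge> 2" and "inj_on lam {1..n}"
    and "p = (\<Prod>i=1..n. [:- complex_of_real (lam i), 1:])"
    and "C \<in> components (sa_roots p)"
  shows "openin (top_of_set (sa_roots p)) C \<and>
    (\<forall>a0\<in>C. \<forall>a1\<in>C. \<exists>s m c.
        unitary s \<and> mult_inv s = adj s \<and>
        a1 = mult_inv s * a0 * s \<and> a1 = adj s * a0 * s \<and>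
        m \<ge> 1 \<and> (\<forall>i\<in>{1..m}. selfadjoint (c i)) \<and>
        s = prod_list (map (\<lambda>i. exp (\<i> *\<^sub>C c i)) [1..<m+1]) \<and>
        (let a = (\<lambda>t::real.
               prod_list (map (\<lambda>i. exp ((- \<i> * complex_of_real t) *\<^sub>C c i)) (rev [1..<m+1]))
               * a0 *
               prod_list (map (\<lambda>i. exp ((\<i> * complex_of_real t) *\<^sub>C c i)) [1..<m+1]))
         in a 0 = a0 \<and> a 1 = a1 \<and> real_analytic_on a {0..1} \<and>
            (\<forall>t\<in>{0..1}. selfadjoint (a t) \<and> a t \<in> C)))"
proof (intro conjI ballI)
  have "inj_on (\<lambda>i. complex_of_real (lam i)) {1..n}"
    by (rule inj_onI) (metis assms(2) inj_onD of_real_eq_iff)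
  then have cop: "coprime p (pderiv p)"
    unfolding assms(3)
    by (rule coprime_pderiv_prod_linear[where lam = "\<lambda>i. complex_of_real (lam i)", OF finite_atLeastAtMost])
  show "openin (top_of_set (sa_roots p)) C"
    using cop assms(4) by (rule openin_component_sa_roots)
  fix a0 a1
  assume a0: "a0 \<in> C" and a1: "a1 \<in> C"
  obtain cs where cs: "cs \<noteq> []" "\<And>c. c \<in> set cs \<Longrightarrow> selfadjoint c"
    "a1 = adj (exp_prod 1 cs) * a0 * exp_prod 1 cs"
    using component_conjugate[OF cop assms(4) a0 a1] by blast
  define s where "s = exp_prod 1 cs"
  define m where "m = length cs"
  define c where "c i = cs ! (i - 1)" for i
  define a where "a = (\<lambda>t::real.
      prod_list (map (\<lambda>i. exp ((- \<i> * complex_of_real t) *\<^sub>C c i)) (rev [1..<m+1]))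
      * a0 * prod_list (map (\<lambda>i. exp ((\<i> * complex_of_real t) *\<^sub>C c i)) [1..<m+1]))"
  \<comment> \<open>The list is indexed from \<open>0\<close>, the family \<open>c\<close> from \<open>1\<close>.\<close>
  have cs_eq: "cs = map c [1..<m+1]"
    by (rule nth_equalityI) (simp_all add: m_def c_def del: upt_Suc)
  have exp_pos: "exp ((\<i> * complex_of_real t) *\<^sub>C d) = exp (t *\<^sub>R (\<i> *\<^sub>C d))"
    and exp_neg: "exp ((- \<i> * complex_of_real t) *\<^sub>C d) = exp ((- t) *\<^sub>R (\<i> *\<^sub>C d))"
    for t and d :: 'a
    by (simp_all add: scaleR_scaleC scaleC_scaleC mult.commute)
  have right: "prod_list (map (\<lambda>i. exp ((\<i> * complex_of_real t) *\<^sub>C c i)) [1..<m+1]) = exp_prod t cs"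
    for t
    unfolding exp_prod_def cs_eq exp_pos map_map o_def ..
  have left: "prod_list (map (\<lambda>i. exp ((- \<i> * complex_of_real t) *\<^sub>C c i)) (rev [1..<m+1]))
      = exp_prod (- t) (rev cs)" for t
    unfolding exp_prod_def cs_eq exp_neg rev_map map_map o_def ..
  have a_exp_prod: "a = (\<lambda>t. exp_prod (- t) (rev cs) * a0 * exp_prod t cs)"
    unfolding a_def left right ..
  have a_adj: "a t = adj (exp_prod t cs) * a0 * exp_prod t cs" for t
    unfolding a_exp_prod by (subst adj_exp_prod) (simp_all add: cs(2))
  have s: "unitary s"
    unfolding s_def using cs(2) by (rule unitary_exp_prod)
  have a_in: "a t \<in> C" for t
    unfolding a_adj by (rule exp_prod_conj_in_component[OF assms(4) a0 cs(2)])
  \<comment> \<open>In the left product the sign of \<open>- t\<close> is moved to the generators \<open>i c\<close>.\<close>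
  have "abs_power_series a x" for x
    unfolding a_exp_prod exp_prod_def scaleR_minus_left scaleR_minus_right[symmetric]
    by (intro abs_power_series_mult abs_power_series_const abs_power_series_prod_list
        abs_power_series_exp)
  then have analytic: "real_analytic_on a {0..1}"
    by (rule real_analytic_on_if_abs_power_series)
  have a1_eq: "a1 = adj s * a0 * s"
    by (simp add: s_def cs(3))
  have ends: "a 0 = a0" "a 1 = a1"
    by (simp_all add: a_adj cs(3))
  have sa: "selfadjoint (a t)" for t
    using a_in[of t] in_components_subset[OF assms(4)] by (auto simp: sa_roots_def)
  have s_eq: "s = prod_list (map (\<lambda>i. exp (\<i> *\<^sub>C c i)) [1..<m+1])"
    using right[of 1] by (simp add: s_def del: upt_Suc)
  have m: "m \<ge> 1"
    using cs(1) by (cases cs) (simp_all add: m_def)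
  have c: "\<forall>i\<in>{1..m}. selfadjoint (c i)"
    using cs(2) by (auto simp: m_def c_def)
  show "\<exists>s m c.
        unitary s \<and> mult_inv s = adj s \<and>
        a1 = mult_inv s * a0 * s \<and> a1 = adj s * a0 * s \<and>
        m \<ge> 1 \<and> (\<forall>i\<in>{1..m}. selfadjoint (c i)) \<and>
        s = prod_list (map (\<lambda>i. exp (\<i> *\<^sub>C c i)) [1..<m+1]) \<and>
        (let a = (\<lambda>t::real.
               prod_list (map (\<lambda>i. exp ((- \<i> * complex_of_real t) *\<^sub>C c i)) (rev [1..<m+1]))
               * a0 *
               prod_list (map (\<lambda>i. exp ((\<i> * complex_of_real t) *\<^sub>C c i)) [1..<m+1]))
         in a 0 = a0 \<and> a 1 = a1 \<and> real_analytic_on a {0..1} \<and>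
            (\<forall>t\<in>{0..1}. selfadjoint (a t) \<and> a t \<in> C))"
    unfolding Let_def
    by (rule exI[of _ s], rule exI[of _ m], rule exI[of _ c])
      (intro conjI ballI s m bspec[OF c] s_eq a1_eq ends[unfolded a_def] analytic[unfolded a_def]
        sa[unfolded a_def] a_in[unfolded a_def] mult_inv_unitary[OF s]
        a1_eq[folded mult_inv_unitary[OF s]])
qed

end
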